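(* For $n\ge0$ let $D_{n}(231,132)$ be the set of derangements of $\{1,\dots,n\}$ (permutations with no fixed point) that avoid both patterns $231$ and $132$. Let $(J_n)_{n\ge0}$ be the Jacobsthal numbers $J_0=0$, $J_1=1$, $J_n=J_{n-1}+2J_{n-2}$ for $n\ge2$. Then for all $n\ge0$, $$J_{n+1}=\sum_{k=0}^n2^{n-k}\binom{k}{n-k}=|D_{n+2}(231,132)|.$$
   Context: A permutation $\pi$ avoids a pattern $p\in S_3$ if there are no indices $i<j<l$ such that $(\pi_i,\pi_j,\pi_l)$ is order-isomorphic to $p$. Binomial coefficients $\binom{k}{j}$ with $j>k$ or $j<0$ are $0$. *)

theory Defs
  imports "HOL-Combinatorics.Permutations"
begin

text \<open>
  Permutations of \<open>{1..n}\<close> are functions on \<^typ>\<open>nat\<close> that permute \<open>{1..n}\<close> in the sense of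
  \<^const>\<open>permutes\<close> (hence are the identity outside \<open>{1..n}\<close>).
  Patterns are given in one-line notation, so that 231 is \<open>[2, 3, 1]\<close>.
\<close>

definition order_isomorphic :: "nat list \<Rightarrow> nat list \<Rightarrow> bool" where
  "order_isomorphic xs ys \<longleftrightarrow>
     length xs = length ys \<and>
     (\<forall>a < length xs. \<forall>b < length xs. xs ! a < xs ! b \<longleftrightarrow> ys ! a < ys ! b)"

definition avoids :: "nat \<Rightarrow> (nat \<Rightarrow> nat) \<Rightarrow> nat list \<Rightarrow> bool" where
  "avoids n \<pi> p \<longleftrightarrow>
     \<not> (\<exists>i j l. 1 \<le> i \<and> i < j \<and> j < l \<and> l \<le> n \<and> order_isomorphic [\<pi> i, \<pi> j, \<pi> l] p)"

definition derangements :: "nat \<Rightarrow> (nat \<Rightarrow> nat) set" where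
  "derangements n = {\<pi>. \<pi> permutes {1..n} \<and> (\<forall>i\<in>{1..n}. \<pi> i \<noteq> i)}"

definition derangements_avoiding :: "nat \<Rightarrow> nat list \<Rightarrow> nat list \<Rightarrow> (nat \<Rightarrow> nat) set" where
  "derangements_avoiding n p q = {\<pi> \<in> derangements n. avoids n \<pi> p \<and> avoids n \<pi> q}"

fun jacobsthal :: "nat \<Rightarrow> nat" where
  "jacobsthal 0 = 0"
| "jacobsthal (Suc 0) = 1"
| "jacobsthal (Suc (Suc n)) = jacobsthal (Suc n) + 2 * jacobsthal n"

end

theory Submission
  imports Defs
begin

text \<open>
  Avoiding 231 and 132 together means having no interior peak, so the largest value of such a
  permutation stands in the first or the last position. Deleting it leaves a peak-free permutation
  again; deleting it from the front moves all other entries one place to the left, which turns the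
  condition \<open>\<pi> i \<noteq> i + s\<close> into \<open>\<pi> i \<noteq> i + (s + 1)\<close>. Hence the numbers \<open>g n s\<close> of peak-free
  permutations of \<open>{1..n}\<close> with \<open>\<pi> i \<noteq> i + s\<close> for all \<open>i\<close> satisfy a two-parameter recursion, which
  is solved by \<open>g n s = 2 ^ (n - 1) - 2 ^ (s - 1) * jacobsthal (n - s)\<close> when \<open>n, s \<ge> 1\<close>. In a
  derangement the largest value has to come first, so the count sought is \<open>g (n + 1) 1\<close>.
\<close>

definition peakless :: "nat \<Rightarrow> (nat \<Rightarrow> nat) \<Rightarrow> bool" where
  "peakless n \<pi> \<longleftrightarrow>
     (\<forall>i j l. 1 \<le> i \<and> i < j \<and> j < l \<and> l \<le> n \<longrightarrow> \<not> (\<pi> i < \<pi> j \<and> \<pi> l < \<pi> j))"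

definition shift_free :: "nat \<Rightarrow> nat \<Rightarrow> (nat \<Rightarrow> nat) set" where
  "shift_free n s = {\<pi>. \<pi> permutes {1..n} \<and> peakless n \<pi> \<and> (\<forall>i\<in>{1..n}. \<pi> i \<noteq> i + s)}"

text \<open>A cycle for precomposition: the one-line notation of
  \<open>\<sigma> \<circ> rotation m\<close> is \<open>\<sigma> m\<close>,
  \<open>\<sigma> 1\<close>, ..., \<open>\<sigma> (m - 1)\<close>, so a largest value in last place
  moves to the front.\<close>

definition rotation :: "nat \<Rightarrow> nat \<Rightarrow> nat" where
  "rotation m i = (if i = 1 then m else if 2 \<le> i \<and> i \<le> m then i - 1 else i)"

section \<open>Pattern avoidance as absence of peaks\<close>

lemma order_isomorphic_231:
  "order_isomorphic [a, b, c] [2, 3, 1] \<longleftrightarrow> c < a \<and> a < b"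
  unfolding order_isomorphic_def by (auto simp: All_less_Suc2 numeral_eq_Suc)

lemma order_isomorphic_132:
  "order_isomorphic [a, b, c] [1, 3, 2] \<longleftrightarrow> a < c \<and> c < b"
  unfolding order_isomorphic_def by (auto simp: All_less_Suc2 numeral_eq_Suc)

text \<open>By injectivity the two outer values of a peak differ; the pattern is 231 or 132
  according to which of them is smaller.\<close>

lemma avoids_231_132_iff_peakless:
  assumes "inj \<pi>"
  shows "avoids n \<pi> [2, 3, 1] \<and> avoids n \<pi> [1, 3, 2] \<longleftrightarrow> peakless n \<pi>"
proof -
  have "\<pi> l < \<pi> i \<and> \<pi> i < \<pi> j \<or> \<pi> i < \<pi> l \<and> \<pi> l < \<pi> j \<longleftrightarrow> \<pi> i < \<pi> j \<and> \<pi> l < \<pi> j"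
    if "i < j" "j < l" for i j l
    using injD[OF assms, of i l] that by (cases "\<pi> i" "\<pi> l" rule: linorder_cases) auto
  then show ?thesis
    unfolding avoids_def peakless_def order_isomorphic_231 order_isomorphic_132 by blast
qed

lemma derangements_avoiding_eq_shift_free:
  "derangements_avoiding n [2, 3, 1] [1, 3, 2] = shift_free n 0"
  unfolding derangements_avoiding_def derangements_def shift_free_def
  using avoids_231_132_iff_peakless[OF permutes_inj] by auto

lemma finite_shift_free: "finite (shift_free n s)"
  unfolding shift_free_def by (rule finite_subset[OF _ finite_permutations[of "{1..n}"]]) auto

lemma shift_free_1: "s \<ge> 1 \<Longrightarrow> shift_free 1 s = {id}"
  by (auto simp: shift_free_def peakless_def)

section \<open>The largest value in first or last position\<close>

lemma permutes_Suc_fix_last: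
  assumes "\<pi> permutes {1..Suc n}" "\<pi> (Suc n) = Suc n"
  shows "\<pi> permutes {1..n}"
  by (rule permutes_superset[OF assms(1)]) (use assms(2) in \<open>auto simp: le_Suc_eq\<close>)

lemma permutes_less_Suc:
  assumes "\<pi> permutes {1..n}" "i \<in> {1..n}"
  shows "\<pi> i < Suc n"
  using permutes_in_image[OF assms(1), of i] assms(2) by auto

text \<open>A largest value at an interior position \<open>p\<close> would form a peak with
  positions \<open>1\<close> and \<open>Suc n\<close>.\<close>

lemma max_at_end:
  assumes "\<pi> permutes {1..Suc n}" "peakless (Suc n) \<pi>"
  shows "\<pi> 1 = Suc n \<or> \<pi> (Suc n) = Suc n"
proof (rule ccontr)
  assume ends: "\<not> ?thesis"
  obtain p where p: "\<pi> p = Suc n" "p \<in> {1..Suc n}"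
    using permutes_image[OF assms(1)] by (metis atLeastAtMost_iff imageE le_add1 le_refl plus_1_eq_Suc)
  have "p \<noteq> 1" "p \<noteq> Suc n"
    using p ends by auto
  then have "1 < p" "p < Suc n"
    using p(2) by auto
  moreover have "\<pi> i < Suc n" if "i \<in> {1..Suc n}" "i \<noteq> p" for i
    using permutes_less_Suc[OF assms(1) that(1)] injD[OF permutes_inj[OF assms(1)], of i p] p that(2)
    by (auto simp: less_Suc_eq)
  ultimately have "\<pi> 1 < \<pi> p" "\<pi> (Suc n) < \<pi> p"
    using p(1) by auto
  then show False
    using assms(2) \<open>1 < p\<close> \<open>p < Suc n\<close> unfolding peakless_def by blast
qed

text \<open>The only new triples end at \<open>Suc n\<close>, whose value exceeds all others, so
  none of them is a peak.\<close>

lemma peakless_Suc_fix_last: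
  assumes "\<pi> permutes {1..n}"
  shows "peakless (Suc n) \<pi> \<longleftrightarrow> peakless n \<pi>"
proof
  assume pl: "peakless n \<pi>"
  have "\<pi> (Suc n) = Suc n"
    using assms by (simp add: permutes_def)
  then have "\<not> \<pi> (Suc n) < \<pi> j" if "1 \<le> j" "j < Suc n" for j
    using permutes_less_Suc[OF assms, of j] that by auto
  then show "peakless (Suc n) \<pi>"
    using pl unfolding peakless_def by (metis le_Suc_eq order.strict_implies_order order_le_less_trans)
qed (auto simp: peakless_def)

text \<open>For \<open>s \<ge> 1\<close> the fixed point \<open>Suc n\<close> satisfies the extra
  condition \<open>\<pi> (Suc n) \<noteq> Suc n + s\<close> automatically.\<close>

lemma shift_free_Suc_fix_last:
  assumes "s \<ge> 1"
  shows "{\<pi> \<in> shift_free (Suc n) s. \<pi> (Suc n) = Suc n} = shift_free n s"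
proof -
  have "\<pi> \<in> shift_free (Suc n) s \<and> \<pi> (Suc n) = Suc n \<longleftrightarrow> \<pi> \<in> shift_free n s" for \<pi>
  proof (cases "\<pi> permutes {1..n}")
    case True
    have "\<pi> (Suc n) = Suc n"
      using True by (simp add: permutes_def)
    moreover have "\<pi> permutes {1..Suc n}"
      using True by (rule permutes_subset) auto
    ultimately show ?thesis
      using True assms peakless_Suc_fix_last[OF True]
      by (auto simp: shift_free_def atLeastAtMostSuc_conv)
  next
    case False
    then show ?thesis
      using permutes_Suc_fix_last by (auto simp: shift_free_def)
  qed
  then show ?thesis by blast
qed

section \<open>Moving the largest value to the front\<close>

lemma rotation_simps:
  "rotation (Suc n) (Suc 0) = Suc n"
  "i \<in> {1..n} \<Longrightarrow> rotation (Suc n) (Suc i) = i"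
  by (auto simp: rotation_def)

lemma rotation_permutes: "rotation (Suc n) permutes {1..Suc n}"
proof (rule bij_imp_permutes)
  have "inj_on (rotation (Suc n)) {1..Suc n}"
    by (auto simp: inj_on_def rotation_def split: if_splits)
  moreover have "rotation (Suc n) ` {1..Suc n} \<subseteq> {1..Suc n}"
    by (auto simp: rotation_def)
  ultimately show "bij_betw (rotation (Suc n)) {1..Suc n} {1..Suc n}"
    by (simp add: bij_betw_def endo_inj_surj)
qed (auto simp: rotation_def)

text \<open>Triples starting at position 1 have the largest value as an outer entry, hence no peak;
  all others are triples of \<open>\<sigma>\<close> moved by one.\<close>

lemma peakless_rotation:
  assumes "\<sigma> permutes {1..n}"
  shows "peakless (Suc n) (\<sigma> \<circ> rotation (Suc n)) \<longleftrightarrow> peakless n \<sigma>"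
proof
  assume pl: "peakless (Suc n) (\<sigma> \<circ> rotation (Suc n))"
  show "peakless n \<sigma>"
    unfolding peakless_def
  proof (intro allI impI)
    fix i j l assume a: "1 \<le> i \<and> i < j \<and> j < l \<and> l \<le> n"
    then show "\<not> (\<sigma> i < \<sigma> j \<and> \<sigma> l < \<sigma> j)"
      using pl[unfolded peakless_def, rule_format, of "Suc i" "Suc j" "Suc l"]
      by (auto simp: rotation_simps)
  qed
next
  assume pl: "peakless n \<sigma>"
  show "peakless (Suc n) (\<sigma> \<circ> rotation (Suc n))"
    unfolding peakless_def
  proof (intro allI impI)
    fix i j l assume a: "1 \<le> i \<and> i < j \<and> j < l \<and> l \<le> Suc n"
    then obtain i' j' l' where s: "i = Suc i'" "j = Suc j'" "l = Suc l'"
      by (metis One_nat_def Suc_le_D less_imp_Suc_add order_less_trans)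
    show "\<not> ((\<sigma> \<circ> rotation (Suc n)) i < (\<sigma> \<circ> rotation (Suc n)) j \<and>
             (\<sigma> \<circ> rotation (Suc n)) l < (\<sigma> \<circ> rotation (Suc n)) j)"
    proof (cases "i' = 0")
      case True
      have "\<sigma> (Suc n) = Suc n"
        using assms by (simp add: permutes_def)
      then show ?thesis
        using True a s permutes_less_Suc[OF assms, of j'] by (auto simp: rotation_simps)
    next
      case False
      then show ?thesis
        using a s pl[unfolded peakless_def, rule_format, of i' j' l'] by (auto simp: rotation_simps)
    qed
  qed
qed

text \<open>The entry \<open>\<sigma> i\<close> now stands at \<open>i + 1\<close>, where
  \<open>i + 1 + s\<close> is forbidden. At position 1 the condition reads
  \<open>Suc n \<noteq> 1 + s\<close>, which is \<open>n \<noteq> s\<close>.\<close>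

lemma rotation_mem_shift_free_iff:
  assumes "\<sigma> permutes {1..n}" "n \<noteq> s"
  shows "\<sigma> \<circ> rotation (Suc n) \<in> shift_free (Suc n) s \<longleftrightarrow> \<sigma> \<in> shift_free n (Suc s)"
proof -
  have last: "\<sigma> (Suc n) = Suc n"
    using assms(1) by (simp add: permutes_def)
  have "(\<forall>i\<in>{1..Suc n}. P i) \<longleftrightarrow> P 1 \<and> (\<forall>i\<in>{1..n}. P (Suc i))" for P
  proof -
    have "{1..Suc n} = insert 1 (Suc ` {1..n})"
      by (simp add: image_Suc_atLeastAtMost atLeastAtMost_insertL)
    then show ?thesis by (simp only: ball_simps)
  qed
  then have "(\<forall>i\<in>{1..Suc n}. (\<sigma> \<circ> rotation (Suc n)) i \<noteq> i + s) \<longleftrightarrow> (\<forall>i\<in>{1..n}. \<sigma> i \<noteq> i + Suc s)"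
    using assms(2) last by (auto simp: rotation_simps)
  moreover have "\<sigma> \<circ> rotation (Suc n) permutes {1..Suc n}"
    by (rule permutes_compose[OF rotation_permutes permutes_subset[OF assms(1)]]) auto
  ultimately show ?thesis
    using assms(1) peakless_rotation[OF assms(1)] by (simp add: shift_free_def)
qed

lemma shift_free_Suc_max_first:
  assumes "n \<noteq> s"
  shows "{\<pi> \<in> shift_free (Suc n) s. \<pi> 1 = Suc n} =
         (\<lambda>\<sigma>. \<sigma> \<circ> rotation (Suc n)) ` shift_free n (Suc s)" (is "?L = ?R")
proof
  show "?R \<subseteq> ?L"
  proof
    fix \<pi> assume "\<pi> \<in> ?R"
    then obtain \<sigma> where \<sigma>: "\<sigma> \<in> shift_free n (Suc s)" "\<pi> = \<sigma> \<circ> rotation (Suc n)"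
      by auto
    then have perm: "\<sigma> permutes {1..n}"
      by (simp add: shift_free_def)
    then have "\<sigma> (Suc n) = Suc n"
      by (simp add: permutes_def)
    then show "\<pi> \<in> ?L"
      using \<sigma> rotation_mem_shift_free_iff[OF perm assms] by (simp add: rotation_simps)
  qed
next
  show "?L \<subseteq> ?R"
  proof
    fix \<pi> assume "\<pi> \<in> ?L"
    then have \<pi>: "\<pi> \<in> shift_free (Suc n) s" "\<pi> permutes {1..Suc n}" "\<pi> 1 = Suc n"
      by (auto simp: shift_free_def)
    \<comment> \<open>Undoing the rotation returns the largest value to the last position, so
      \<open>\<sigma>\<close> restricts to \<open>{1..n}\<close>.\<close>
    define \<sigma> where "\<sigma> = \<pi> \<circ> inv (rotation (Suc n))"
    have eq: "\<pi> = \<sigma> \<circ> rotation (Suc n)"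
      unfolding \<sigma>_def comp_assoc permutes_inv_o(2)[OF rotation_permutes] by simp
    have "\<sigma> permutes {1..Suc n}"
      unfolding \<sigma>_def by (rule permutes_compose[OF permutes_inv[OF rotation_permutes] \<pi>(2)])
    moreover have "\<sigma> (Suc n) = Suc n"
      using \<pi>(3) by (simp add: eq rotation_simps)
    ultimately have "\<sigma> permutes {1..n}"
      by (rule permutes_Suc_fix_last)
    then show "\<pi> \<in> ?R"
      using \<pi>(1) eq rotation_mem_shift_free_iff[OF _ assms, of \<sigma>] by auto
  qed
qed

section \<open>The two-parameter recursion and its solution\<close>

lemma card_shift_free_max_first:
  assumes "n \<noteq> s"
  shows "card {\<pi> \<in> shift_free (Suc n) s. \<pi> 1 = Suc n} = card (shift_free n (Suc s))"
proof -
  have "inj_on (\<lambda>\<sigma>. \<sigma> \<circ> rotation (Suc n)) (shift_free n (Suc s))"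
    using permutes_surj[OF rotation_permutes[of n]]
    by (intro inj_onI) (auto simp: fun.inj_map_strong intro: surj_fun_eq)
  then show ?thesis
    unfolding shift_free_Suc_max_first[OF assms] by (rule card_image)
qed

lemma card_shift_free_Suc:
  assumes "n \<ge> 1" "s \<ge> 1"
  shows "card (shift_free (Suc n) s) =
         card (shift_free n s) + (if n = s then 0 else card (shift_free n (Suc s)))"
proof -
  let ?A = "{\<pi> \<in> shift_free (Suc n) s. \<pi> (Suc n) = Suc n}"
  let ?B = "{\<pi> \<in> shift_free (Suc n) s. \<pi> 1 = Suc n}"
  have "shift_free (Suc n) s = ?A \<union> ?B"
    using max_at_end by (auto simp: shift_free_def)
  moreover have "?A \<inter> ?B = {}"
  proof -
    have "\<pi> 1 \<noteq> \<pi> (Suc n)" if "\<pi> \<in> shift_free (Suc n) s" for \<pi>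
      using that assms(1) permutes_inj[of \<pi> "{1..Suc n}"] by (auto simp: shift_free_def dest: injD)
    then show ?thesis by (smt (verit) disjoint_iff mem_Collect_eq)
  qed
  ultimately have "card (shift_free (Suc n) s) = card ?A + card ?B"
    using finite_shift_free[of "Suc n" s] by (metis (no_types, lifting) card_Un_disjoint finite_Un)
  \<comment> \<open>For \<open>n = s\<close> the value \<open>Suc n\<close> is exactly the one
    forbidden at position 1.\<close>
  moreover have "card ?B = 0" if "n = s"
  proof -
    have "?B = {}"
      using that by (auto simp: shift_free_def dest!: bspec[where x = 1])
    then show ?thesis by (simp only: card.empty)
  qed
  ultimately show ?thesis
    unfolding shift_free_Suc_fix_last[OF assms(2)]
    using card_shift_free_max_first[of n s] by presburger
qed

text \<open>
  For \<open>s \<ge> n\<close> the subtraction truncates and the Jacobsthal term vanishes, as it should: the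
  condition \<open>\<pi> i \<noteq> i + s\<close> is then void.
\<close>
lemma card_shift_free:
  assumes "n \<ge> 1" "s \<ge> 1"
  shows "card (shift_free n s) + 2 ^ (s - 1) * jacobsthal (n - s) = 2 ^ (n - 1)"
  using assms
proof (induction n arbitrary: s rule: nat_induct_at_least)
  case base
  then show ?case by (simp add: shift_free_1[unfolded One_nat_def])
next
  case (Suc n)
  have IH: "card (shift_free n s) + 2 ^ (s - 1) * jacobsthal (n - s) = 2 ^ (n - 1)"
    "card (shift_free n (Suc s)) + 2 ^ s * jacobsthal (n - Suc s) = 2 ^ (n - 1)"
    using Suc.IH[of s] Suc.IH[of "Suc s"] Suc.prems by auto
  have pow: "(2::nat) ^ n = 2 * 2 ^ (n - 1)" "(2::nat) ^ s = 2 * 2 ^ (s - 1)"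
    using Suc.hyps Suc.prems by (simp_all flip: power_Suc)
  \<comment> \<open>For \<open>n = s\<close> the missing summand is made up by
    \<open>2 ^ (s - 1) * jacobsthal 1\<close>; for \<open>n < s\<close> all Jacobsthal terms are 0;
    for \<open>s < n\<close> adding both parts of \<open>IH\<close> produces the Jacobsthal
    recursion.\<close>
  consider "n = s" | "n < s" | "s < n" by linarith
  then show ?case
  proof cases
    case 3
    then obtain d where d: "n = Suc (s + d)"
      using less_imp_Suc_add by blast
    then show ?thesis
      using IH pow card_shift_free_Suc[OF Suc.hyps Suc.prems] 3
      by (simp add: Suc_diff_le algebra_simps)
  qed (use IH pow card_shift_free_Suc[OF Suc.hyps Suc.prems] in auto)
qed

section \<open>Jacobsthal numbers, derangements and the binomial sum\<close>

lemma jacobsthal_Suc_add: "jacobsthal (Suc n) + jacobsthal n = 2 ^ n"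
  by (induction n) auto

text \<open>A largest value in last position would be a fixed point, so it comes first. Removing it
  leaves \<open>shift_free (n + 1) 1\<close>, of size \<open>2 ^ n - jacobsthal n\<close>, which is
  \<open>jacobsthal (n + 1)\<close>.\<close>

lemma card_derangements_avoiding:
  "card (derangements_avoiding (n + 2) [2, 3, 1] [1, 3, 2]) = jacobsthal (n + 1)"
proof -
  have "\<pi> 1 = Suc (Suc n)" if "\<pi> \<in> shift_free (Suc (Suc n)) 0" for \<pi>
    using max_at_end[of \<pi> "Suc n"] that by (auto simp: shift_free_def)
  then have "shift_free (Suc (Suc n)) 0 = {\<pi> \<in> shift_free (Suc (Suc n)) 0. \<pi> 1 = Suc (Suc n)}"
    by blast
  then have "card (shift_free (Suc (Suc n)) 0) = card (shift_free (Suc n) 1)"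
    using card_shift_free_max_first[of "Suc n" 0] by simp
  then show ?thesis
    using card_shift_free[of "Suc n" 1] jacobsthal_Suc_add[of n]
    unfolding derangements_avoiding_eq_shift_free by simp
qed

lemma sum_binomial_Suc_Suc:
  fixes S :: "nat \<Rightarrow> nat"
  defines "S \<equiv> \<lambda>n. \<Sum>k = 0..n. 2 ^ (n - k) * (k choose (n - k))"
  shows "S (Suc (Suc n)) = S (Suc n) + 2 * S n"
proof -
  \<comment> \<open>The summand for \<open>k = 0\<close> vanishes, so the index can be
    shifted.\<close>
  have "S (Suc (Suc n)) = (\<Sum>k = 0..Suc n. 2 ^ (Suc n - k) * (Suc k choose (Suc n - k)))"
    unfolding S_def by (subst sum.atLeast0_atMost_Suc_shift) simp
  also have "\<dots> = (\<Sum>k = 0..n. 2 ^ (Suc n - k) * (Suc k choose (Suc n - k))) + 1"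
    by simp
  \<comment> \<open>Pascal's rule; splitting off \<open>k = Suc n\<close> ensured
    \<open>Suc n - k = Suc (n - k)\<close>.\<close>
  also have "(\<Sum>k = 0..n. 2 ^ (Suc n - k) * (Suc k choose (Suc n - k))) =
      (\<Sum>k = 0..n. 2 ^ (Suc n - k) * (k choose (Suc n - k)) + 2 * (2 ^ (n - k) * (k choose (n - k))))"
    by (rule sum.cong) (auto simp: Suc_diff_le algebra_simps)
  \<comment> \<open>The 1 split off earlier is the summand for \<open>k = Suc n\<close> of
    \<open>S (Suc n)\<close>.\<close>
  also have "\<dots> + 1 = S (Suc n) + 2 * S n"
    unfolding S_def by (simp add: sum.distrib sum_distrib_left)
  finally show ?thesis .
qed

lemma jacobsthal_eq_sum_binomial:
  "jacobsthal (Suc n) = (\<Sum>k = 0..n. 2 ^ (n - k) * (k choose (n - k)))"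
proof (induction n rule: induct_nat_012)
  case (ge2 n)
  then show ?case
    by (simp only: jacobsthal.simps(3) sum_binomial_Suc_Suc)
qed auto

theorem theorem5p1:
  fixes n :: nat
  shows "jacobsthal (n + 1) = (\<Sum>k = 0..n. 2 ^ (n - k) * (k choose (n - k)))
       \<and> (\<Sum>k = 0..n. 2 ^ (n - k) * (k choose (n - k)))
           = card (derangements_avoiding (n + 2) [2, 3, 1] [1, 3, 2])"
  using jacobsthal_eq_sum_binomial[of n] card_derangements_avoiding[of n] by simp

end
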